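(* Let $U=\mathfrak{m}^l\cdot\mathcal{C}^m$ and let $f\colon U\to\mathcal{C}^p$ be a textile map with $f(0)=0$. Write $f=\ell+h$ with $\ell=T_0f$ the tangent map of $f$ at $0$. Assume that $\ell$ admits a scission $\sigma$ for which $\sigma h$ is contractive on $U$, and that $f$ has constant rank at $0$ with respect to $\ker(\ell\sigma)$. Then there exist textile maps $u\colon U\to\mathcal{C}^m$ and $v\colon f(U)\to\mathcal{C}^p$, locally invertible at $0$, such that $$v\circ f\circ u^{-1}=\ell .$$
   Context: Let $k$ be a field of characteristic $0$, $n\ge1$. A cord is a family $c=(c_\alpha)_{\alpha\in\mathbb{N}^n}$ in $k$ ($\mathbb N\ni 0$); the space $\mathcal{C}$ of cords is identified with $k[[x_1,\dots,x_n]]$, with maximal ideal $\mathfrak{m}$. For $c\in\mathcal{C}^m$, $\mathrm{ord}\,c$ is the minimum of the orders of its components as power series. $\mathcal{C}^m$ carries the $\mathfrak{m}$-adic topology with basic neighbourhoods $\mathfrak{m}^l\cdot\mathcal{C}^m$ of $0$. Textile maps: a map $\mathcal{C}^m\to\mathcal{C}^p$ is textile if every coefficient of the image of $c$ is a polynomial over $k$ (in finitely many variables) in the coefficients of $c$; a map on a subset is textile if it is the restriction of a textile map defined on the whole space. Tangent map: $T_af\cdot v=\frac1s\big(f(a+sv)-f(a)\big)\big|_{s=0}$, i.e. coefficientwise the formal directional derivative at $a$ in direction $v$. For $f$ defined on $U=\mathfrak m^l\cdot\mathcal C^m$ and $a\in U$, $T_af$ is regarded as a linear map $U\to\mathcal{C}^p$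 (the tangent space of $U$ at $a$ is identified with $U$). Contractive: $g\colon U\to\mathcal{C}^q$ is contractive on $U$ if $\mathrm{ord}(g(a)-g(b))>\mathrm{ord}(a-b)$ for all $a\neq b$ in $U$. Scission: a scission of a textile linear map $\ell\colon V\to W$ is a textile linear map $\sigma\colon W\to V$ with $\ell\sigma\ell=\ell$; here $\ell\colon U\to\mathcal{C}^p$ and $\sigma\colon\mathcal{C}^p\to U\subseteq\mathcal{C}^m$. Then $\mathcal{C}^p=\mathrm{im}(\ell)\oplus\ker(\ell\sigma)$. Curves: a curve in a subset $S\subseteq\mathcal{C}^q$ is a textile map $\gamma\colon V\to\mathcal{C}^q$ with image in $S$, where $V$ is an $\mathfrak{m}$-adic neighbourhood of $0$ in $\mathcal{C}$. Constant rank: let $J\subseteq\mathcal{C}^p$ be a closed linear direct complement of $\mathrm{im}(T_0f)$. $f$ has constant rank at $0$ with respect to $J$ if for all curves $\gamma$ in $U$ with $\gamma(0)=0$ and all curves $\eta$ in $\mathcal{C}^p$ (over the same $V$) there exist curves $\rho$ in $U$ and $\tau$ in $J$ with $\eta=T_\gamma f\cdot\rho+\tau$, where $T_\gamma f\cdot\rho$ is the curve $s\mapsto T_{\gamma(s)}f\cdot\rho(s)$, and this decomposition of $\eta$ is unique. Locally invertible at $0$ means: admitting, on a suitable $\mathfrak{m}$-adic neighbourhood of $0$ (intersected with the domain), a textile inverse defined on the image; the equation $v\circ f\circ u^{-1}=\ell$ is understood on an $\mathfrak{m}$-adic neighbourhood of $0$. *)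

theory Defs
  imports "HOL-Analysis.Analysis" "HOL-Library.Poly_Mapping" "HOL-Library.Extended_Nat"
    "HOL-Computational_Algebra.Polynomial"
begin

section \<open>Cords as formal power series in several variables\<close>

text \<open>
  A cord is a family of elements of \<open>'k\<close> indexed by \<open>\<nat>\<^sup>n\<close>, where \<open>n = CARD('n) \<ge> 1\<close>. Cords get
  their own type because their product is the one of power series, not the pointwise one.
\<close>

typedef (overloaded) ('n::finite, 'k) cord = "UNIV :: (nat ^ 'n \<Rightarrow> 'k) set"
  morphisms cf Cord ..

setup_lifting type_definition_cord

lemma cord_eq_iff: "c = d \<longleftrightarrow> (\<forall>\<alpha>. cf c \<alpha> = cf d \<alpha>)"
  by (metis cf_inject ext)

definition splits :: "nat ^ 'n::finite \<Rightarrow> ((nat ^ 'n) \<times> (nat ^ 'n)) set" where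
  "splits \<alpha> = {(\<beta>, \<gamma>). \<beta> + \<gamma> = \<alpha>}"

lemma finite_splits [simp]: "finite (splits \<alpha>)"
proof -
  let ?B = "{\<beta> :: nat ^ 'a. \<forall>i. \<beta> $ i \<in> {..\<alpha> $ i}}"
  have "?B \<subseteq> vec_lambda ` (PiE UNIV (\<lambda>i. {..\<alpha> $ i}))"
    by (auto simp: PiE_def image_iff intro!: bexI[of _ "vec_nth _"])
  then have fin: "finite ?B"
    by (rule finite_subset) (intro finite_imageI finite_PiE, auto)
  have "splits \<alpha> \<subseteq> ?B \<times> ?B"
    by (auto simp: splits_def)
  then show ?thesis
    using fin finite_subset by blast
qed

instantiation cord :: (finite, comm_ring_1) comm_ring_1
begin

lift_definition zero_cord :: "('a, 'b) cord" is "\<lambda>_. 0" .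

lift_definition one_cord :: "('a, 'b) cord" is "\<lambda>\<alpha>. if \<alpha> = 0 then 1 else 0" .

lift_definition plus_cord :: "('a, 'b) cord \<Rightarrow> ('a, 'b) cord \<Rightarrow> ('a, 'b) cord"
  is "\<lambda>c d \<alpha>. c \<alpha> + d \<alpha>" .

lift_definition minus_cord :: "('a, 'b) cord \<Rightarrow> ('a, 'b) cord \<Rightarrow> ('a, 'b) cord"
  is "\<lambda>c d \<alpha>. c \<alpha> - d \<alpha>" .

lift_definition uminus_cord :: "('a, 'b) cord \<Rightarrow> ('a, 'b) cord"
  is "\<lambda>c \<alpha>. - c \<alpha>" .

lift_definition times_cord :: "('a, 'b) cord \<Rightarrow> ('a, 'b) cord \<Rightarrow> ('a, 'b) cord"
  is "\<lambda>c d \<alpha>. \<Sum>(\<beta>, \<gamma>)\<in>splits \<alpha>. c \<beta> * d \<gamma>" .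

instance
proof
  fix a b c :: "('a, 'b) cord"
  show "a * b * c = a * (b * c)"
  proof (transfer, rule ext)
    fix a b c :: "nat ^ 'a \<Rightarrow> 'b" and \<alpha> :: "nat ^ 'a"
    have "(\<Sum>(\<beta>, \<gamma>)\<in>splits \<alpha>. (\<Sum>(\<delta>, \<epsilon>)\<in>splits \<beta>. a \<delta> * b \<epsilon>) * c \<gamma>) =
        (\<Sum>(p, q)\<in>(SIGMA p:splits \<alpha>. splits (fst p)). a (fst q) * b (snd q) * c (snd p))"
      by (subst sum.Sigma[symmetric]) (auto simp: sum_distrib_right split_def)
    also have "\<dots> = (\<Sum>(p, q)\<in>(SIGMA p:splits \<alpha>. splits (snd p)). a (fst p) * (b (fst q) * c (snd q)))"
      by (rule sum.reindex_bij_witness[of _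
            "\<lambda>(p, q). ((fst p + fst q, snd q), (fst p, fst q))"
            "\<lambda>(p, q). ((fst q, snd q + snd p), (snd q, snd p))"])
         (auto simp: splits_def algebra_simps)
    also have "\<dots> = (\<Sum>(\<beta>, \<gamma>)\<in>splits \<alpha>. a \<beta> * (\<Sum>(\<delta>, \<epsilon>)\<in>splits \<gamma>. b \<delta> * c \<epsilon>))"
      by (subst sum.Sigma[symmetric]) (auto simp: sum_distrib_left split_def)
    finally show "(\<Sum>(\<beta>, \<gamma>)\<in>splits \<alpha>. (\<Sum>(\<delta>, \<epsilon>)\<in>splits \<beta>. a \<delta> * b \<epsilon>) * c \<gamma>) =
        (\<Sum>(\<beta>, \<gamma>)\<in>splits \<alpha>. a \<beta> * (\<Sum>(\<delta>, \<epsilon>)\<in>splits \<gamma>. b \<delta> * c \<epsilon>))" .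
  qed
  show "a * b = b * a"
  proof (transfer, rule ext)
    fix a b :: "nat ^ 'a \<Rightarrow> 'b" and \<alpha> :: "nat ^ 'a"
    show "(\<Sum>(\<beta>, \<gamma>)\<in>splits \<alpha>. a \<beta> * b \<gamma>) = (\<Sum>(\<beta>, \<gamma>)\<in>splits \<alpha>. b \<beta> * a \<gamma>)"
      by (rule sum.reindex_bij_witness[of _ prod.swap prod.swap])
         (auto simp: splits_def algebra_simps)
  qed
  show "1 * a = a"
  proof (transfer, rule ext)
    fix a :: "nat ^ 'a \<Rightarrow> 'b" and \<alpha> :: "nat ^ 'a"
    have "(\<Sum>(\<beta>, \<gamma>)\<in>splits \<alpha>. (if \<beta> = 0 then 1 else 0) * a \<gamma>) =
        (\<Sum>p\<in>splits \<alpha>. if p = (0, \<alpha>) then a \<alpha> else 0)"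
      by (rule sum.cong) (auto simp: splits_def split: if_splits)
    also have "\<dots> = a \<alpha>"
      by (subst sum.delta[OF finite_splits]) (simp add: splits_def)
    finally show "(\<Sum>(\<beta>, \<gamma>)\<in>splits \<alpha>. (if \<beta> = 0 then 1 else 0) * a \<gamma>) = a \<alpha>" .
  qed
  show "(a + b) * c = a * c + b * c"
    by transfer (auto simp: sum.distrib[symmetric] algebra_simps split_def fun_eq_iff)
  show "0 \<noteq> (1 :: ('a, 'b) cord)"
    by transfer (metis zero_neq_one)
qed (transfer, simp add: fun_eq_iff algebra_simps)+

end

text \<open>\<open>\<C>\<^sup>m\<close> is \<open>(('n, 'k) cord) ^ 'm\<close> with \<open>m = CARD('m)\<close>; its vector space structure over \<open>'k\<close> is:\<close>

definition kscale :: "'k::comm_ring_1 \<Rightarrow> ('n::finite, 'k) cord ^ 'm \<Rightarrow> ('n, 'k) cord ^ 'm::finite" where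
  "kscale s c = (\<chi> i. Cord (\<lambda>\<alpha>. s * cf (c $ i) \<alpha>))"

definition klinear_on ::
    "(('n::finite, 'k::comm_ring_1) cord ^ 'm) set \<Rightarrow> (('n, 'k) cord ^ 'm \<Rightarrow> ('n, 'k) cord ^ 'p) \<Rightarrow> bool" where
  "klinear_on V g \<longleftrightarrow>
    (\<forall>x\<in>V. \<forall>y\<in>V. g (x + y) = g x + g y) \<and> (\<forall>s. \<forall>x\<in>V. g (kscale s x) = kscale s (g x))"


section \<open>Order and the adic topology\<close>

definition ord_series :: "('n::finite, 'k::zero) cord \<Rightarrow> enat" where
  "ord_series c = Inf {enat (\<Sum>i\<in>UNIV. \<alpha> $ i) | \<alpha>. cf c \<alpha> \<noteq> 0}"

definition ord_cord :: "('n::finite, 'k::zero) cord ^ 'm::finite \<Rightarrow> enat" where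
  "ord_cord c = Min (range (\<lambda>i. ord_series (c $ i)))"

definition max_ideal :: "('n::finite, 'k::comm_ring_1) cord set" where
  "max_ideal = {c. cf c 0 = 0}"

text \<open>
  \<open>I \<cdot> J\<close> and \<open>I \<cdot> N\<close> are generated by the products, i.e. consist of all finite sums of products.
\<close>

primrec max_ideal_power :: "nat \<Rightarrow> ('n::finite, 'k::comm_ring_1) cord set" where
  "max_ideal_power 0 = UNIV"
| "max_ideal_power (Suc l) =
    module.span (*) {a * b | a b. a \<in> max_ideal \<and> b \<in> max_ideal_power l}"

definition madic_ball :: "nat \<Rightarrow> (('n::finite, 'k::comm_ring_1) cord ^ 'm) set" where
  "madic_ball l = module.span (*s) {a *s c | a c. a \<in> max_ideal_power l}"

definition madic_nhd :: "(('n::finite, 'k::comm_ring_1) cord ^ 'm) set \<Rightarrow> bool" where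
  "madic_nhd V \<longleftrightarrow> (\<exists>l. madic_ball l \<subseteq> V)"

definition madic_closed :: "(('n::finite, 'k::comm_ring_1) cord ^ 'm) set \<Rightarrow> bool" where
  "madic_closed S \<longleftrightarrow> (\<forall>x. x \<notin> S \<longrightarrow> (\<exists>l. \<forall>y\<in>madic_ball l. x + y \<notin> S))"


section \<open>Textile maps\<close>

definition peval :: "('v \<Rightarrow> 'k) \<Rightarrow> (('v \<Rightarrow>\<^sub>0 nat) \<Rightarrow>\<^sub>0 'k) \<Rightarrow> 'k::comm_semiring_1" where
  "peval g P = (\<Sum>\<mu>\<in>Poly_Mapping.keys P. Poly_Mapping.lookup P \<mu> *
      (\<Prod>v\<in>Poly_Mapping.keys \<mu>. g v ^ Poly_Mapping.lookup \<mu> v))"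

text \<open>The polynomial variable \<open>(j, \<beta>)\<close> stands for the coefficient with index \<open>\<beta>\<close> of the \<open>j\<close>-th component.\<close>

definition textile ::
    "(('n::finite, 'k::comm_ring_1) cord ^ 'm \<Rightarrow> ('n, 'k) cord ^ 'p) \<Rightarrow> bool" where
  "textile F \<longleftrightarrow>
    (\<forall>i \<alpha>. \<exists>P :: ('m \<times> (nat ^ 'n) \<Rightarrow>\<^sub>0 nat) \<Rightarrow>\<^sub>0 'k.
      \<forall>c. cf (F c $ i) \<alpha> = peval (\<lambda>(j, \<beta>). cf (c $ j) \<beta>) P)"

definition textile_on ::
    "(('n::finite, 'k::comm_ring_1) cord ^ 'm) set \<Rightarrow> (('n, 'k) cord ^ 'm \<Rightarrow> ('n, 'k) cord ^ 'p) \<Rightarrow> bool" where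
  "textile_on S f \<longleftrightarrow> (\<exists>F. textile F \<and> (\<forall>x\<in>S. f x = F x))"

text \<open>
  Each coefficient of \<open>(1/s) (f (a + s v) - f a)\<close> is a polynomial in \<open>s\<close>, which is determined by its
  values at \<open>s \<noteq> 0\<close> because \<open>'k\<close> is infinite; the tangent map evaluates this polynomial at \<open>0\<close>.
  If \<open>f\<close> is textile on \<open>U = madic_ball l\<close>, then for \<open>a, v \<in> U\<close> only the values of \<open>f\<close> on \<open>U\<close> enter.
\<close>

definition tangent ::
    "(('n::finite, 'k::field_char_0) cord ^ 'm \<Rightarrow> ('n, 'k) cord ^ 'p)
      \<Rightarrow> ('n, 'k) cord ^ 'm \<Rightarrow> ('n, 'k) cord ^ 'm \<Rightarrow> ('n, 'k) cord ^ 'p" where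
  "tangent f a v =
    (\<chi> i. Cord (\<lambda>\<alpha>. poly
      (THE q. \<forall>s. s \<noteq> 0 \<longrightarrow>
        poly q s = 1 / s * (cf (f (a + kscale s v) $ i) \<alpha> - cf (f a $ i) \<alpha>)) 0))"

definition contractive_on ::
    "(('n::finite, 'k::comm_ring_1) cord ^ 'm) set \<Rightarrow> (('n, 'k) cord ^ 'm \<Rightarrow> ('n, 'k) cord ^ 'q) \<Rightarrow> bool" where
  "contractive_on U g \<longleftrightarrow> (\<forall>a\<in>U. \<forall>b\<in>U. a \<noteq> b \<longrightarrow> ord_cord (g a - g b) > ord_cord (a - b))"

definition scission ::
    "(('n::finite, 'k::comm_ring_1) cord ^ 'm) set \<Rightarrow> (('n, 'k) cord ^ 'p) set
      \<Rightarrow> (('n, 'k) cord ^ 'm \<Rightarrow> ('n, 'k) cord ^ 'p) \<Rightarrow> (('n, 'k) cord ^ 'p \<Rightarrow> ('n, 'k) cord ^ 'm) \<Rightarrow> bool" where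
  "scission V W L \<sigma> \<longleftrightarrow>
    textile_on V L \<and> klinear_on V L \<and> L ` V \<subseteq> W \<and>
    textile_on W \<sigma> \<and> klinear_on W \<sigma> \<and> \<sigma> ` W \<subseteq> V \<and>
    (\<forall>x\<in>V. L (\<sigma> (L x)) = L x)"


section \<open>Curves and constant rank\<close>

text \<open>\<open>\<C>\<close> as the source of curves is \<open>\<C>\<^sup>1\<close>. Only the values on the neighbourhood \<open>V\<close> matter.\<close>

definition curve ::
    "(('n::finite, 'k::comm_ring_1) cord ^ 1) set \<Rightarrow> (('n, 'k) cord ^ 'q) set
      \<Rightarrow> (('n, 'k) cord ^ 1 \<Rightarrow> ('n, 'k) cord ^ 'q) \<Rightarrow> bool" where
  "curve V S \<gamma> \<longleftrightarrow> madic_nhd V \<and> textile_on V \<gamma> \<and> \<gamma> ` V \<subseteq> S"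

definition closed_complement ::
    "(('n::finite, 'k::comm_ring_1) cord ^ 'p) set \<Rightarrow> (('n, 'k) cord ^ 'p) set \<Rightarrow> bool" where
  "closed_complement I J \<longleftrightarrow>
    madic_closed J \<and> module.subspace kscale J \<and>
    I \<inter> J = {0} \<and> (\<forall>y. \<exists>a\<in>I. \<exists>b\<in>J. y = a + b)"

text \<open>
  Uniqueness of the decomposition refers to its two summands; \<open>\<rho>\<close> itself is only determined modulo the
  kernels of the tangent maps.
\<close>

definition constant_rank ::
    "(('n::finite, 'k::field_char_0) cord ^ 'm) set \<Rightarrow> (('n, 'k) cord ^ 'm \<Rightarrow> ('n, 'k) cord ^ 'p)
      \<Rightarrow> (('n, 'k) cord ^ 'p) set \<Rightarrow> bool" where
  "constant_rank U f J \<longleftrightarrow>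
    closed_complement (tangent f 0 ` U) J \<and>
    (\<forall>V \<gamma> \<eta>. curve V U \<gamma> \<and> \<gamma> 0 = 0 \<and> curve V UNIV \<eta> \<longrightarrow>
      (\<exists>\<rho> \<tau>. curve V U \<rho> \<and> curve V J \<tau> \<and>
        (\<forall>s\<in>V. \<eta> s = tangent f (\<gamma> s) (\<rho> s) + \<tau> s) \<and>
        (\<forall>\<rho>' \<tau>'. curve V U \<rho>' \<and> curve V J \<tau>' \<and>
          (\<forall>s\<in>V. \<eta> s = tangent f (\<gamma> s) (\<rho>' s) + \<tau>' s) \<longrightarrow>
          (\<forall>s\<in>V. tangent f (\<gamma> s) (\<rho>' s) = tangent f (\<gamma> s) (\<rho> s) \<and> \<tau>' s = \<tau> s))))"


section \<open>Local invertibility\<close>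

text \<open>\<open>w\<close> is a textile inverse, defined on \<open>g ` (N \<inter> S)\<close>, of the restriction of \<open>g\<close> to \<open>N \<inter> S\<close>.\<close>

definition local_inverse_at_0 ::
    "(('n::finite, 'k::comm_ring_1) cord ^ 'm) set \<Rightarrow> (('n, 'k) cord ^ 'm \<Rightarrow> ('n, 'k) cord ^ 'q)
      \<Rightarrow> (('n, 'k) cord ^ 'm) set \<Rightarrow> (('n, 'k) cord ^ 'q \<Rightarrow> ('n, 'k) cord ^ 'm) \<Rightarrow> bool" where
  "local_inverse_at_0 S g N w \<longleftrightarrow>
    madic_nhd N \<and> textile_on (g ` (N \<inter> S)) w \<and> (\<forall>x\<in>N \<inter> S. w (g x) = x)"

definition locally_invertible_at_0 ::
    "(('n::finite, 'k::comm_ring_1) cord ^ 'm) set \<Rightarrow> (('n, 'k) cord ^ 'm \<Rightarrow> ('n, 'k) cord ^ 'q) \<Rightarrow> bool" where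
  "locally_invertible_at_0 S g \<longleftrightarrow> (\<exists>N w. local_inverse_at_0 S g N w)"


section \<open>Consistency of the definitions\<close>

lemma module_cord: "module ((*) :: ('n::finite, 'k::comm_ring_1) cord \<Rightarrow> _)"
  by unfold_locales (auto simp: algebra_simps)

lemma module_cord_vec: "module ((*s) :: ('n::finite, 'k::comm_ring_1) cord \<Rightarrow> _ ^ 'm \<Rightarrow> _)"
  by unfold_locales (auto simp: vec_eq_iff algebra_simps)

lemma cf_Cord [simp]: "cf (Cord c) = c"
  by (simp add: Cord_inverse)

lemma cf_simps [simp]:
  "cf (c + d) \<alpha> = cf c \<alpha> + cf d \<alpha>" "cf 0 \<alpha> = 0"
  "cf (c - d) \<alpha> = cf c \<alpha> - cf d \<alpha>" "cf (- c) \<alpha> = - cf c \<alpha>"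
  by (transfer, simp)+

lemma cf_times: "cf (c * d) \<alpha> = (\<Sum>(\<beta>, \<gamma>)\<in>splits \<alpha>. cf c \<beta> * cf d \<gamma>)"
  by transfer simp

lemma cf_sum: "cf (sum h A) \<alpha> = (\<Sum>x\<in>A. cf (h x) \<alpha>)"
  by (induction A rule: infinite_finite_induct) auto

lemma vector_space_kscale:
  "vector_space (kscale :: 'k::field \<Rightarrow> ('n::finite, 'k) cord ^ 'm \<Rightarrow> _)"
  by unfold_locales (auto simp: kscale_def vec_eq_iff cord_eq_iff algebra_simps)

lemma max_ideal_power_eq:
  "max_ideal_power l = {c :: ('n::finite, 'k::comm_ring_1) cord. \<forall>\<alpha>. (\<Sum>i\<in>UNIV. \<alpha> $ i) < l \<longrightarrow> cf c \<alpha> = 0}"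
proof (induction l)
  case 0
  then show ?case by simp
next
  case (Suc l)
  interpret module "(*) :: ('n, 'k) cord \<Rightarrow> _" by (rule module_cord)
  let ?D = "\<lambda>\<alpha> :: nat ^ 'n. \<Sum>i\<in>UNIV. \<alpha> $ i"
  let ?I = "\<lambda>l. {c :: ('n, 'k) cord. \<forall>\<alpha>. ?D \<alpha> < l \<longrightarrow> cf c \<alpha> = 0}"
  let ?P = "{a * b | a b. a \<in> max_ideal \<and> b \<in> ?I l}"
  have D0: "?D \<beta> > 0" if "\<beta> \<noteq> 0" for \<beta> :: "nat ^ 'n"
    by (rule gr0I) (use that in \<open>auto simp: vec_eq_iff sum_eq_0_iff\<close>)
  have Dadd: "?D (\<beta> + \<gamma>) = ?D \<beta> + ?D \<gamma>" for \<beta> \<gamma> :: "nat ^ 'n"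
    by (simp add: sum.distrib)
  have mult: "cf (a * b) \<alpha> = 0" if "a \<in> max_ideal" "b \<in> ?I l" "?D \<alpha> < Suc l"
    for a b :: "('n, 'k) cord" and \<alpha>
    unfolding cf_times
  proof (rule sum.neutral, clarify)
    fix \<beta> \<gamma> assume "(\<beta>, \<gamma>) \<in> splits \<alpha>"
    then have *: "?D \<alpha> = ?D \<beta> + ?D \<gamma>" using Dadd by (auto simp: splits_def)
    show "cf a \<beta> * cf b \<gamma> = 0"
    proof (cases "\<beta> = 0")
      case True
      then show ?thesis using that(1) by (simp add: max_ideal_def)
    next
      case False
      then have "?D \<gamma> < l" using * that(3) D0[OF False] by linarith
      then show ?thesis using that(2) by simp
    qed
  qed
  have sc: "cf (a * b) \<alpha> = 0" if "b \<in> ?I (Suc l)" "?D \<alpha> < Suc l" for a b :: "('n, 'k) cord" and \<alpha>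
    unfolding cf_times
  proof (rule sum.neutral, clarify)
    fix \<beta> \<gamma> assume "(\<beta>, \<gamma>) \<in> splits \<alpha>"
    then have "?D \<alpha> = ?D \<beta> + ?D \<gamma>" using Dadd by (auto simp: splits_def)
    then have "?D \<gamma> < Suc l" using that(2) by linarith
    then show "cf a \<beta> * cf b \<gamma> = 0" using that(1) by simp
  qed
  have "span ?P \<subseteq> ?I (Suc l)"
  proof (rule span_minimal)
    show "?P \<subseteq> ?I (Suc l)" using mult by blast
    show "subspace (?I (Suc l))" using sc by (auto simp: subspace_def)
  qed
  moreover have "c \<in> span ?P" if c: "c \<in> ?I (Suc l)" for c :: "('n, 'k) cord"
  proof -
    define pick where "pick \<alpha> = (SOME i. \<alpha> $ i > 0)" for \<alpha> :: "nat ^ 'n"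
    define e where "e i = (axis i 1 :: nat ^ 'n)" for i
    define X :: "'n \<Rightarrow> ('n, 'k) cord" where "X i = Cord (\<lambda>\<alpha>. if \<alpha> = e i then 1 else 0)" for i
    define d where "d i = Cord (\<lambda>\<beta>. if pick (\<beta> + e i) = i then cf c (\<beta> + e i) else 0)" for i
    have De: "?D (e i) = 1" for i
      by (simp add: e_def axis_def)
    have e0: "e i \<noteq> 0" for i
      using De[of i] by auto
    have mem: "X i * d i \<in> ?P" for i
    proof -
      have "cf (d i) \<beta> = 0" if "?D \<beta> < l" for \<beta>
      proof -
        have "?D (\<beta> + e i) < Suc l" using that De[of i] Dadd[of \<beta> "e i"] by linarith
        then show ?thesis using c by (simp add: d_def)
      qed
      moreover have "X i \<in> max_ideal"
        using e0[of i] by (auto simp: X_def max_ideal_def)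
      ultimately show ?thesis by blast
    qed
    have Xd: "cf (X i * d i) \<alpha> = (if \<alpha> $ i > 0 \<and> pick \<alpha> = i then cf c \<alpha> else 0)" for i \<alpha>
    proof (cases "\<alpha> $ i > 0")
      case True
      then have eq: "e i + (\<alpha> - e i) = \<alpha>"
        by (auto simp: vec_eq_iff e_def axis_def)
      have "cf (X i * d i) \<alpha> = (\<Sum>p\<in>splits \<alpha>. if p = (e i, \<alpha> - e i) then cf (d i) (\<alpha> - e i) else 0)"
        unfolding cf_times
        by (rule sum.cong) (auto simp: X_def splits_def split: if_splits)
      also have "\<dots> = cf (d i) (\<alpha> - e i)"
        using eq by (subst sum.delta[OF finite_splits]) (simp add: splits_def)
      finally show ?thesis
        using True eq by (simp add: d_def add.commute)
    next
      case False
      have "cf (X i * d i) \<alpha> = 0"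
        unfolding cf_times
      proof (rule sum.neutral, clarify)
        fix \<beta> \<gamma> assume "(\<beta>, \<gamma>) \<in> splits \<alpha>"
        then have "\<beta> \<noteq> e i" using False by (auto simp: splits_def e_def axis_def)
        then show "cf (X i) \<beta> * cf (d i) \<gamma> = 0" by (simp add: X_def)
      qed
      then show ?thesis using False by simp
    qed
    have "c = (\<Sum>i\<in>UNIV. X i * d i)"
      unfolding cord_eq_iff
    proof
      fix \<alpha>
      show "cf c \<alpha> = cf (\<Sum>i\<in>UNIV. X i * d i) \<alpha>"
      proof (cases "\<alpha> = 0")
        case True
        then show ?thesis using c by (simp add: cf_sum Xd)
      next
        case False
        then have "\<exists>i. \<alpha> $ i > 0" by (auto simp: vec_eq_iff)
        then have "\<alpha> $ pick \<alpha> > 0" unfolding pick_def by (rule someI_ex)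
        then have "(if \<alpha> $ i > 0 \<and> pick \<alpha> = i then cf c \<alpha> else 0) = (if i = pick \<alpha> then cf c \<alpha> else 0)" for i
          by auto
        then show ?thesis by (simp add: cf_sum Xd)
      qed
    qed
    then show ?thesis using mem by (metis (no_types, lifting) span_base span_sum)
  qed
  ultimately have "span ?P = ?I (Suc l)" by blast
  then show ?case using Suc by simp
qed

lemma le_ord_series_iff:
  "enat l \<le> ord_series c \<longleftrightarrow> (\<forall>\<alpha>. (\<Sum>i\<in>UNIV. \<alpha> $ i) < l \<longrightarrow> cf c \<alpha> = 0)"
  unfolding ord_series_def le_Inf_iff by (force simp: not_less)

lemma le_ord_cord_iff: "enat l \<le> ord_cord c \<longleftrightarrow> (\<forall>i. enat l \<le> ord_series (c $ i))"
  unfolding ord_cord_def by (subst Min_ge_iff) auto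

lemma madic_ball_eq:
  "madic_ball l = {c :: ('n::finite, 'k::comm_ring_1) cord ^ 'm::finite. enat l \<le> ord_cord c}"
proof -
  interpret C: module "(*) :: ('n, 'k) cord \<Rightarrow> _" by (rule module_cord)
  interpret module "(*s) :: ('n, 'k) cord \<Rightarrow> _ ^ 'm \<Rightarrow> _" by (rule module_cord_vec)
  let ?I = "max_ideal_power l :: ('n, 'k) cord set"
  let ?P = "{a *s c | a (c :: ('n, 'k) cord ^ 'm). a \<in> ?I}"
  have ideal: "C.subspace ?I"
    by (cases l) (auto intro: C.subspace_span)
  have eq: "{c :: ('n, 'k) cord ^ 'm. enat l \<le> ord_cord c} = {c. \<forall>i. c $ i \<in> ?I}"
    by (simp add: le_ord_cord_iff le_ord_series_iff max_ideal_power_eq)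
  have "span ?P \<subseteq> {c. \<forall>i. c $ i \<in> ?I}"
  proof (rule span_minimal)
    show "?P \<subseteq> {c. \<forall>i. c $ i \<in> ?I}"
    proof clarify
      fix a :: "('n, 'k) cord" and c :: "('n, 'k) cord ^ 'm" and i
      assume "a \<in> ?I"
      then show "(a *s c) $ i \<in> ?I"
        using C.subspace_scale[OF ideal, of a "c $ i"] by (simp add: mult.commute)
    qed
    show "subspace {c. \<forall>i. c $ i \<in> ?I}"
      using ideal by (auto simp: subspace_def C.subspace_def)
  qed
  moreover have "c \<in> span ?P" if "\<forall>i. c $ i \<in> ?I" for c :: "('n, 'k) cord ^ 'm"
  proof -
    have "c = (\<Sum>i\<in>UNIV. c $ i *s axis i 1)"
      by (simp add: vec_eq_iff axis_def if_distrib[of "\<lambda>x. _ * x"] cong: if_cong)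
    moreover have "(\<Sum>i\<in>UNIV. c $ i *s axis i 1) \<in> span ?P"
      using that by (intro span_sum span_base) blast
    ultimately show ?thesis by simp
  qed
  ultimately show ?thesis
    unfolding madic_ball_def eq by blast
qed

end

theory Submission
  imports Defs
begin

text \<open>
  Write \<open>u = id + \<sigma> h\<close>. Contractivity makes \<open>u\<close> a bijection of \<open>U\<close> whose inverse \<open>w\<close> is textile, since
  the coefficients of the inverse are computed degree by degree. As \<open>L \<sigma> L = L\<close>, the map \<open>fw = f \<circ> w\<close>
  satisfies \<open>L \<sigma> fw = L\<close> on \<open>U\<close>. Hence its derivatives in directions from \<open>ker L\<close> lie in \<open>ker (L \<sigma>)\<close>;
  the uniqueness of the decomposition in the definition of constant rank, applied to \<open>\<eta> = 0\<close> along
  the curves \<open>s \<mapsto> w (s\<^sub>0 y)\<close> with \<open>s\<^sub>0\<close> the constant coefficient of \<open>s\<close>, shows that they vanish. In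
  characteristic \<open>0\<close> this means that \<open>fw\<close> is constant along \<open>ker L\<close>, that is \<open>fw \<sigma> L = fw\<close>. So
  \<open>v = L \<sigma>\<close> is inverted on \<open>f ` U\<close> by \<open>fw \<sigma>\<close>, and \<open>v f w = L\<close>.
\<close>

section \<open>Polynomial functions of the coefficients\<close>

text \<open>An inductive form of the polynomial functions on cords: closure properties and
  derivatives are then proved by rule induction. \<open>polyfun_iff_peval\<close> ties it to
  \<open>peval\<close>.\<close>

inductive_set polyfun :: "(('n::finite, 'k::comm_ring_1) cord ^ 'm::finite \<Rightarrow> 'k) set" where
  const: "(\<lambda>_. a) \<in> polyfun"
| coord: "(\<lambda>c. cf (c $ j) \<beta>) \<in> polyfun"
| add: "\<phi> \<in> polyfun \<Longrightarrow> \<psi> \<in> polyfun \<Longrightarrow> (\<lambda>c. \<phi> c + \<psi> c) \<in> polyfun"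
| mult: "\<phi> \<in> polyfun \<Longrightarrow> \<psi> \<in> polyfun \<Longrightarrow> (\<lambda>c. \<phi> c * \<psi> c) \<in> polyfun"

definition monom_eval :: "('v \<Rightarrow> 'k::comm_semiring_1) \<Rightarrow> ('v \<Rightarrow>\<^sub>0 nat) \<Rightarrow> 'k" where
  "monom_eval g \<mu> = (\<Prod>v\<in>Poly_Mapping.keys \<mu>. g v ^ Poly_Mapping.lookup \<mu> v)"

text \<open>Additional variables contribute factors with exponent 0; two monomials can thus be
  evaluated over one common index set.\<close>

lemma monom_eval_superset:
  assumes "finite A" "Poly_Mapping.keys \<mu> \<subseteq> A"
  shows "monom_eval g \<mu> = (\<Prod>v\<in>A. g v ^ Poly_Mapping.lookup \<mu> v)"
  unfolding monom_eval_def
  by (rule prod.mono_neutral_left) (use assms in \<open>auto simp: in_keys_iff\<close>)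

lemma monom_eval_0 [simp]: "monom_eval g 0 = 1"
  by (simp add: monom_eval_def)

lemma monom_eval_single [simp]: "monom_eval g (Poly_Mapping.single v 1) = g v"
  by (simp add: monom_eval_def)

lemma monom_eval_add: "monom_eval g (\<mu> + \<nu>) = monom_eval g \<mu> * monom_eval g \<nu>"
proof -
  let ?A = "Poly_Mapping.keys \<mu> \<union> Poly_Mapping.keys \<nu>"
  have "Poly_Mapping.keys (\<mu> + \<nu>) \<subseteq> ?A"
    by (rule keys_add)
  then show ?thesis
    by (simp add: monom_eval_superset[of ?A] lookup_add power_add prod.distrib)
qed

lemma peval_superset:
  assumes "finite A" "Poly_Mapping.keys P \<subseteq> A"
  shows "peval g P = (\<Sum>\<mu>\<in>A. Poly_Mapping.lookup P \<mu> * monom_eval g \<mu>)"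
  unfolding peval_def monom_eval_def
  by (rule sum.mono_neutral_left) (use assms in \<open>auto simp: in_keys_iff\<close>)

lemma peval_eq: "peval g P = (\<Sum>\<mu>\<in>Poly_Mapping.keys P. Poly_Mapping.lookup P \<mu> * monom_eval g \<mu>)"
  by (rule peval_superset) auto

lemma peval_add: "peval g (P + Q) = peval g P + peval g Q"
proof -
  let ?A = "Poly_Mapping.keys P \<union> Poly_Mapping.keys Q"
  have "Poly_Mapping.keys (P + Q) \<subseteq> ?A"
    by (rule keys_add)
  then show ?thesis
    by (simp add: peval_superset[of ?A] lookup_add distrib_right sum.distrib)
qed

lemma peval_sum: "peval g (\<Sum>x\<in>A. P x) = (\<Sum>x\<in>A. peval g (P x))"
proof (induction A rule: infinite_finite_induct)
  case (insert x A)
  then show ?case by (simp add: peval_add)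
qed (simp_all add: peval_eq)

lemma peval_single [simp]: "peval g (Poly_Mapping.single \<mu> a) = a * monom_eval g \<mu>"
  by (simp add: peval_superset[of "{\<mu>}"])

text \<open>The witness expands the product over pairs of monomials. Pairs with equal \<mu> + \<nu>
  do no harm, because evaluation is additive over the single terms.\<close>

lemma peval_mult_ex: "\<exists>R. \<forall>g. peval g R = peval g P * peval g Q"
proof (intro exI allI)
  fix g :: "'a \<Rightarrow> 'b"
  show "peval g (\<Sum>\<mu>\<in>Poly_Mapping.keys P. \<Sum>\<nu>\<in>Poly_Mapping.keys Q.
      Poly_Mapping.single (\<mu> + \<nu>) (Poly_Mapping.lookup P \<mu> * Poly_Mapping.lookup Q \<nu>)) =
      peval g P * peval g Q"
    by (simp add: peval_sum monom_eval_add peval_eq[of g P] peval_eq[of g Q] sum_product mult_ac)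
qed

lemma polyfun_power: "\<phi> \<in> polyfun \<Longrightarrow> (\<lambda>c. \<phi> c ^ n) \<in> polyfun"
  by (induction n) (auto intro: polyfun.intros)

lemma polyfun_prod: "(\<And>x. x \<in> A \<Longrightarrow> \<phi> x \<in> polyfun) \<Longrightarrow> (\<lambda>c. \<Prod>x\<in>A. \<phi> x c) \<in> polyfun"
  by (induction A rule: infinite_finite_induct) (auto intro: polyfun.intros)

lemma polyfun_sum: "(\<And>x. x \<in> A \<Longrightarrow> \<phi> x \<in> polyfun) \<Longrightarrow> (\<lambda>c. \<Sum>x\<in>A. \<phi> x c) \<in> polyfun"
  by (induction A rule: infinite_finite_induct) (auto intro: polyfun.intros)

lemma polyfun_iff_peval:
  "\<phi> \<in> polyfun \<longleftrightarrow> (\<exists>P. \<forall>c. \<phi> c = peval (\<lambda>(j, \<beta>). cf (c $ j) \<beta>) P)"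
proof
  assume "\<phi> \<in> polyfun"
  then show "\<exists>P. \<forall>c. \<phi> c = peval (\<lambda>(j, \<beta>). cf (c $ j) \<beta>) P"
  proof induction
    case (const a)
    show ?case by (rule exI[of _ "Poly_Mapping.single 0 a"]) simp
  next
    case (coord j \<beta>)
    show ?case
      by (rule exI[of _ "Poly_Mapping.single (Poly_Mapping.single (j, \<beta>) 1) 1"])
         (simp del: One_nat_def)
  next
    case (add \<phi> \<psi>)
    then show ?case by (metis peval_add)
  next
    case (mult \<phi> \<psi>)
    then obtain P Q where "\<forall>c. \<phi> c = peval (\<lambda>(j, \<beta>). cf (c $ j) \<beta>) P"
      "\<forall>c. \<psi> c = peval (\<lambda>(j, \<beta>). cf (c $ j) \<beta>) Q" by blast
    moreover obtain R where "\<forall>g. peval g R = peval g P * peval g Q"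
      using peval_mult_ex by blast
    ultimately show ?case by metis
  qed
next
  assume "\<exists>P. \<forall>c. \<phi> c = peval (\<lambda>(j, \<beta>). cf (c $ j) \<beta>) P"
  then obtain P where "\<phi> = (\<lambda>c. peval (\<lambda>(j, \<beta>). cf (c $ j) \<beta>) P)" by auto
  moreover have "(\<lambda>c. case x of (j, \<beta>) \<Rightarrow> cf (c $ j) \<beta>) \<in> polyfun" for x :: "'c \<times> (nat ^ 'a)"
    by (cases x) (simp add: polyfun.coord)
  ultimately show "\<phi> \<in> polyfun"
    unfolding peval_def
    by (auto intro!: polyfun_sum polyfun.mult polyfun.const polyfun_prod polyfun_power)
qed

lemma textile_iff: "textile F \<longleftrightarrow> (\<forall>i \<alpha>. (\<lambda>c. cf (F c $ i) \<alpha>) \<in> polyfun)"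
  unfolding textile_def polyfun_iff_peval ..

text \<open>Substitution into a polynomial, by induction on \<phi>; the textility of
  \<open>F\<close> enters at the coordinate functions.\<close>

lemma polyfun_compose:
  assumes "\<phi> \<in> polyfun" "textile F"
  shows "(\<lambda>c. \<phi> (F c)) \<in> polyfun"
  using assms(1) by induction (use assms(2) in \<open>auto simp: textile_iff intro: polyfun.intros\<close>)

lemma textile_compose: "textile G \<Longrightarrow> textile F \<Longrightarrow> textile (\<lambda>c. G (F c))"
  using polyfun_compose[of _ F] unfolding textile_iff[of G] textile_iff[of "\<lambda>c. G (F c)"] by blast

lemma textile_const: "textile (\<lambda>_. a)"
  by (simp add: textile_iff polyfun.const)

lemma textile_ident: "textile (\<lambda>c. c)"
  by (simp add: textile_iff polyfun.coord)

lemma textile_add: "textile F \<Longrightarrow> textile G \<Longrightarrow> textile (\<lambda>c. F c + G c)"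
  by (simp add: textile_iff polyfun.add)

lemma textile_uminus: "textile F \<Longrightarrow> textile (\<lambda>c. - F c)"
  using polyfun.mult[OF polyfun.const[of "-1"]] by (fastforce simp: textile_iff)

lemma textile_diff: "textile F \<Longrightarrow> textile G \<Longrightarrow> textile (\<lambda>c. F c - G c)"
  using textile_add[OF _ textile_uminus, of F G] by simp

lemma textile_imp_textile_on: "textile F \<Longrightarrow> textile_on S F"
  by (auto simp: textile_on_def)

lemma textile_on_UNIV [simp]: "textile_on UNIV F \<longleftrightarrow> textile F"
proof
  assume "textile_on UNIV F"
  then obtain G where "textile G" "\<forall>x. F x = G x" by (auto simp: textile_on_def)
  then show "textile F" by (metis ext)
qed (rule textile_imp_textile_on)

lemma vec_cord_eqI: "(\<And>i \<alpha>. cf (c $ i) \<alpha> = cf (d $ i) \<alpha>) \<Longrightarrow> c = d"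
  by (simp add: vec_eq_iff cord_eq_iff)

lemma cf_kscale [simp]: "cf (kscale s c $ i) \<alpha> = s * cf (c $ i) \<alpha>"
  by (simp add: kscale_def)


section \<open>Neighbourhoods and contractive maps\<close>

abbreviation total_degree :: "nat ^ 'n::finite \<Rightarrow> nat" where
  "total_degree \<alpha> \<equiv> \<Sum>i\<in>UNIV. \<alpha> $ i"

lemma mem_madic_ball: "c \<in> madic_ball l \<longleftrightarrow> (\<forall>i \<alpha>. total_degree \<alpha> < l \<longrightarrow> cf (c $ i) \<alpha> = 0)"
  by (simp add: madic_ball_eq le_ord_cord_iff le_ord_series_iff)

lemma madic_ball_closed:
  "0 \<in> madic_ball l"
  "x \<in> madic_ball l \<Longrightarrow> y \<in> madic_ball l \<Longrightarrow> x + y \<in> madic_ball l"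
  "x \<in> madic_ball l \<Longrightarrow> y \<in> madic_ball l \<Longrightarrow> x - y \<in> madic_ball l"
  "x \<in> madic_ball l \<Longrightarrow> kscale s x \<in> madic_ball l"
  by (auto simp: mem_madic_ball)

lemma madic_nhd_UNIV: "madic_nhd UNIV"
  by (simp add: madic_nhd_def)

text \<open>The topology is Hausdorff: a coefficient of degree d is detected by the ball of index d
  + 1.\<close>

lemma madic_ball_separated: "(\<And>k. x - y \<in> madic_ball k) \<Longrightarrow> x = y"
proof (rule vec_cord_eqI)
  fix i \<alpha>
  assume "\<And>k. x - y \<in> madic_ball k"
  from this[of "Suc (total_degree \<alpha>)"] have "cf ((x - y) $ i) \<alpha> = 0"
    unfolding mem_madic_ball by blast
  then show "cf (x $ i) \<alpha> = cf (y $ i) \<alpha>" by simp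
qed

text \<open>A textile retraction onto the ball. It allows inverses on the ball to be defined, and
  textile, on the whole space.\<close>

definition ball_proj :: "nat \<Rightarrow> ('n::finite, 'k::comm_ring_1) cord ^ 'm::finite \<Rightarrow> ('n, 'k) cord ^ 'm" where
  "ball_proj l c = (\<chi> i. Cord (\<lambda>\<alpha>. if total_degree \<alpha> < l then 0 else cf (c $ i) \<alpha>))"

lemma ball_proj_in: "ball_proj l c \<in> madic_ball l"
  by (simp add: ball_proj_def mem_madic_ball)

lemma ball_proj_id: "c \<in> madic_ball l \<Longrightarrow> ball_proj l c = c"
  by (rule vec_cord_eqI) (simp add: ball_proj_def mem_madic_ball)

lemma textile_ball_proj: "textile (ball_proj l)"
  unfolding textile_iff
proof (intro allI)
  fix i \<alpha>
  show "(\<lambda>c. cf (ball_proj l c $ i) \<alpha>) \<in> polyfun"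
    by (cases "total_degree \<alpha> < l") (simp_all add: ball_proj_def polyfun.const polyfun.coord)
qed

text \<open>Orders take values in \<open>enat\<close>, so a strict increase of the order gains at
  least one degree.\<close>

lemma contractive_on_ball:
  assumes "contractive_on U g" "a \<in> U" "b \<in> U" "a - b \<in> madic_ball k"
  shows "g a - g b \<in> madic_ball (Suc k)"
proof (cases "a = b")
  case True
  then show ?thesis by (simp add: madic_ball_closed)
next
  case False
  have "enat k \<le> ord_cord (a - b)" using assms(4) by (simp add: madic_ball_eq)
  also have "\<dots> < ord_cord (g a - g b)" using assms False by (auto simp: contractive_on_def)
  finally show ?thesis by (simp add: madic_ball_eq Suc_ile_eq)
qed

text \<open>Fixed-point iteration for w = y - g(w). Each step settles one more degree, so every
  coefficient of the limit already occurs in a finite iterate and is polynomial in y.\<close>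

lemma contractive_perturbation_inverse:
  fixes g :: "('n::finite, 'k::comm_ring_1) cord ^ 'm::finite \<Rightarrow> ('n, 'k) cord ^ 'm"
  assumes g: "textile g" "\<And>x. x \<in> madic_ball l \<Longrightarrow> g x \<in> madic_ball l"
    and contr: "contractive_on (madic_ball l) g"
  obtains w where "textile w" "\<And>y. w y \<in> madic_ball l"
    "\<And>y. y \<in> madic_ball l \<Longrightarrow> w y + g (w y) = y"
    "\<And>x. x \<in> madic_ball l \<Longrightarrow> w (x + g x) = x"
proof -
  define W where "W = rec_nat (\<lambda>_. 0) (\<lambda>_ F y. ball_proj l y - g (F y))"
  have W0: "W 0 y = 0" and WS: "W (Suc k) y = ball_proj l y - g (W k y)" for k y
    by (simp_all add: W_def)
  have WU: "W k y \<in> madic_ball l" for k y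
    by (induction k) (auto simp: W0 WS madic_ball_closed ball_proj_in g)
  have Wtex: "textile (W k)" for k
  proof (induction k)
    case 0
    have "W 0 = (\<lambda>_. 0)" by (simp add: fun_eq_iff W0)
    then show ?case by (simp add: textile_const)
  next
    case (Suc k)
    have "W (Suc k) = (\<lambda>y. ball_proj l y - g (W k y))" by (simp add: fun_eq_iff WS)
    then show ?case using textile_diff[OF textile_ball_proj textile_compose[OF g(1) Suc]] by simp
  qed
  have step: "W k y - W (Suc k) y \<in> madic_ball k" for k y
  proof (induction k)
    case 0
    show ?case by (simp add: mem_madic_ball)
  next
    case (Suc k)
    have "W (Suc k) y - W (Suc (Suc k)) y = 0 - (g (W k y) - g (W (Suc k) y))"
      by (simp add: WS)
    then show ?case
      using contractive_on_ball[OF contr WU WU Suc] madic_ball_closed by metis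
  qed
  \<comment> \<open>Iterates k and k + 1 agree in degrees below k, so a coefficient of degree d is
    frozen from iterate d + 1 on.\<close>
  have stable: "cf (W k y $ i) \<alpha> = cf (W (Suc (total_degree \<alpha>)) y $ i) \<alpha>"
    if "total_degree \<alpha> < k" for k y i \<alpha>
    using that
  proof (induction k)
    case (Suc k)
    show ?case
    proof (cases "total_degree \<alpha> = k")
      case False
      then have lt: "total_degree \<alpha> < k" using Suc.prems by simp
      then have "cf (W k y $ i) \<alpha> = cf (W (Suc k) y $ i) \<alpha>"
        using step[of k y] by (simp add: mem_madic_ball)
      then show ?thesis using Suc.IH[OF lt] by simp
    qed simp
  qed simp
  define w where "w y = (\<chi> i. Cord (\<lambda>\<alpha>. cf (W (Suc (total_degree \<alpha>)) y $ i) \<alpha>))" for y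
  have wtex: "textile w"
    using Wtex by (simp add: textile_iff w_def)
  have wU: "w y \<in> madic_ball l" for y
    using WU unfolding mem_madic_ball w_def by simp
  have near: "w y - W k y \<in> madic_ball k" for k y
    unfolding mem_madic_ball w_def using stable[symmetric] by auto
  have uw: "w y + g (w y) = y" if "y \<in> madic_ball l" for y
  proof (rule madic_ball_separated)
    fix k
    have "g (w y) - g (W k y) \<in> madic_ball (Suc k)"
      by (rule contractive_on_ball[OF contr wU WU near])
    \<comment> \<open>By the recursion for \<open>W\<close>, the sum of these two small differences
      is exactly the defect of the fixed-point equation.\<close>
    then have "w y - W (Suc k) y + (g (w y) - g (W k y)) \<in> madic_ball (Suc k)"
      by (rule madic_ball_closed(2)[OF near])
    moreover have "w y - W (Suc k) y + (g (w y) - g (W k y)) = w y + g (w y) - y"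
      using that by (simp add: WS ball_proj_id)
    ultimately show "w y + g (w y) - y \<in> madic_ball k"
      by (simp add: mem_madic_ball)
  qed
  \<comment> \<open>Both \<open>w (x + g x)\<close> and \<open>x\<close> solve the same equation.
    Their difference is minus the difference of their \<open>g\<close>-values, so contractivity
    pushes it into every ball.\<close>
  have wu: "w (x + g x) = x" if x: "x \<in> madic_ball l" for x
  proof (rule madic_ball_separated)
    fix k
    have eq: "w (x + g x) + g (w (x + g x)) = x + g x"
      by (rule uw) (simp add: x g madic_ball_closed)
    show "w (x + g x) - x \<in> madic_ball k"
    proof (induction k)
      case 0
      show ?case by (simp add: mem_madic_ball)
    next
      case (Suc k)
      have "w (x + g x) - x = 0 - (g (w (x + g x)) - g x)"
        using eq by (simp add: algebra_simps)
      then show ?case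
        using contractive_on_ball[OF contr wU x Suc] madic_ball_closed by metis
    qed
  qed
  show thesis by (rule that[OF wtex wU uw wu])
qed


section \<open>Derivatives of polynomial paths\<close>

text \<open>Differentiation is formal: each coefficient is its own polynomial in the parameter, with
  no common degree bound over the coefficients.\<close>

definition path_deriv ::
    "('k::field_char_0 \<Rightarrow> ('n::finite, 'k) cord ^ 'm::finite) \<Rightarrow> ('k \<Rightarrow> ('n, 'k) cord ^ 'm) \<Rightarrow> bool" where
  "path_deriv c c' \<longleftrightarrow>
    (\<forall>i \<alpha>. \<exists>q. \<forall>t. cf (c t $ i) \<alpha> = poly q t \<and> cf (c' t $ i) \<alpha> = poly (pderiv q) t)"

lemma path_deriv_line: "path_deriv (\<lambda>t. a + kscale t v) (\<lambda>_. v)"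
  unfolding path_deriv_def
proof (intro allI)
  fix i \<alpha>
  show "\<exists>q. \<forall>t. cf ((a + kscale t v) $ i) \<alpha> = poly q t \<and> cf (v $ i) \<alpha> = poly (pderiv q) t"
    by (rule exI[of _ "[:cf (a $ i) \<alpha>, cf (v $ i) \<alpha>:]"]) (simp add: pderiv_pCons)
qed

lemma path_deriv_const: "path_deriv (\<lambda>_. a) (\<lambda>_. 0)"
  using path_deriv_line[of a 0] by (simp add: kscale_def cord_eq_iff vec_eq_iff path_deriv_def)

text \<open>Characteristic 0 enters here: a polynomial with zero formal derivative is
  constant.\<close>

lemma path_deriv_zero_imp_const:
  assumes "path_deriv c (\<lambda>_. 0)"
  shows "c s = c t"
proof (rule vec_cord_eqI)
  fix i \<alpha>
  obtain q where q: "\<And>t. cf (c t $ i) \<alpha> = poly q t" "\<And>t. poly (pderiv q) t = 0"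
    using assms unfolding path_deriv_def by (metis cf_simps(2) zero_index)
  then have "pderiv q = 0" by (simp add: poly_all_0_iff_0[symmetric])
  then obtain a where "q = [:a:]" using pderiv_iszero by blast
  then show "cf (c s $ i) \<alpha> = cf (c t $ i) \<alpha>" by (simp add: q)
qed

definition polyfun_deriv ::
    "(('n::finite, 'k::field_char_0) cord ^ 'm::finite \<Rightarrow> 'k)
      \<Rightarrow> (('n, 'k) cord ^ 'm \<Rightarrow> ('n, 'k) cord ^ 'm \<Rightarrow> 'k) \<Rightarrow> bool" where
  "polyfun_deriv \<phi> D \<longleftrightarrow> (\<forall>v. (\<lambda>a. D a v) \<in> polyfun) \<and> (\<forall>c c'. path_deriv c c' \<longrightarrow>
    (\<exists>r. \<forall>t. \<phi> (c t) = poly r t \<and> D (c t) (c' t) = poly (pderiv r) t))"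

lemma polyfun_deriv_add:
  fixes \<phi> \<psi> :: "('n::finite, 'k::field_char_0) cord ^ 'm::finite \<Rightarrow> 'k"
  assumes "polyfun_deriv \<phi> D" "polyfun_deriv \<psi> E"
  shows "polyfun_deriv (\<lambda>c. \<phi> c + \<psi> c) (\<lambda>a v. D a v + E a v)"
  unfolding polyfun_deriv_def
proof (intro conjI allI impI)
  fix v show "(\<lambda>a. D a v + E a v) \<in> polyfun"
    using assms by (simp add: polyfun_deriv_def polyfun.add)
next
  fix c c' :: "'k \<Rightarrow> ('n, 'k) cord ^ 'm" assume "path_deriv c c'"
  then obtain r s where "\<forall>t. \<phi> (c t) = poly r t \<and> D (c t) (c' t) = poly (pderiv r) t"
    "\<forall>t. \<psi> (c t) = poly s t \<and> E (c t) (c' t) = poly (pderiv s) t"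
    using assms unfolding polyfun_deriv_def by blast
  then show "\<exists>r. \<forall>t. \<phi> (c t) + \<psi> (c t) = poly r t \<and>
      D (c t) (c' t) + E (c t) (c' t) = poly (pderiv r) t"
    by (intro exI[of _ "r + s"]) (simp add: pderiv_add)
qed

lemma polyfun_deriv_mult:
  fixes \<phi> \<psi> :: "('n::finite, 'k::field_char_0) cord ^ 'm::finite \<Rightarrow> 'k"
  assumes "polyfun_deriv \<phi> D" "polyfun_deriv \<psi> E" "\<phi> \<in> polyfun" "\<psi> \<in> polyfun"
  shows "polyfun_deriv (\<lambda>c. \<phi> c * \<psi> c) (\<lambda>a v. \<phi> a * E a v + \<psi> a * D a v)"
  unfolding polyfun_deriv_def
proof (intro conjI allI impI)
  fix v show "(\<lambda>a. \<phi> a * E a v + \<psi> a * D a v) \<in> polyfun"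
    using assms by (simp add: polyfun_deriv_def polyfun.add polyfun.mult)
next
  fix c c' :: "'k \<Rightarrow> ('n, 'k) cord ^ 'm" assume "path_deriv c c'"
  then obtain r s where "\<forall>t. \<phi> (c t) = poly r t \<and> D (c t) (c' t) = poly (pderiv r) t"
    "\<forall>t. \<psi> (c t) = poly s t \<and> E (c t) (c' t) = poly (pderiv s) t"
    using assms(1,2) unfolding polyfun_deriv_def by blast
  then show "\<exists>r. \<forall>t. \<phi> (c t) * \<psi> (c t) = poly r t \<and>
      \<phi> (c t) * E (c t) (c' t) + \<psi> (c t) * D (c t) (c' t) = poly (pderiv r) t"
    by (intro exI[of _ "r * s"]) (simp add: pderiv_mult)
qed

lemma polyfun_deriv_ex:
  assumes "\<phi> \<in> polyfun"
  shows "\<exists>D. polyfun_deriv \<phi> D"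
  using assms
proof induction
  case (const a)
  have "\<forall>t. a = poly [:a:] t \<and> 0 = poly (pderiv [:a:]) t" by (simp add: pderiv_pCons)
  then show ?case
    unfolding polyfun_deriv_def by (intro exI[of _ "\<lambda>_ _. 0"]) (blast intro: polyfun.const)
next
  case (coord j \<beta>)
  show ?case
    by (rule exI[of _ "\<lambda>_ v. cf (v $ j) \<beta>"])
       (simp add: polyfun_deriv_def polyfun.const path_deriv_def)
next
  case (add \<phi> \<psi>)
  then show ?case using polyfun_deriv_add by blast
next
  case (mult \<phi> \<psi>)
  then show ?case using polyfun_deriv_mult by blast
qed

text \<open>If a coefficient along the line is r(t), its difference quotient is (r - r(0)) / X,
  whose value at 0 is r'(0). This evaluates the \<open>THE\<close> in
  \<open>tangent\<close>.\<close>

lemma tangent_eq_path_deriv: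
  assumes "path_deriv (\<lambda>t. f (a + kscale t v)) e'"
  shows "tangent f a v = e' 0"
proof (rule vec_cord_eqI)
  fix i \<alpha>
  obtain r where r: "\<And>t. cf (f (a + kscale t v) $ i) \<alpha> = poly r t"
    "\<And>t. cf (e' t $ i) \<alpha> = poly (pderiv r) t"
    using assms unfolding path_deriv_def by metis
  have "a + kscale 0 v = a" by (rule vec_cord_eqI) simp
  then have r0: "cf (f a $ i) \<alpha> = poly r 0" using r(1)[of 0] by simp
  have "poly (r - [:poly r 0:]) 0 = 0" by simp
  then obtain q where q: "r - [:poly r 0:] = [:0, 1:] * q"
    by (metis dvdE poly_eq_0_iff_dvd minus_zero)
  then have rq: "r = [:poly r 0:] + [:0, 1:] * q" by (simp add: algebra_simps)
  have pq: "poly r s = poly r 0 + s * poly q s" for s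
    by (subst rq) simp
  let ?Q = "\<lambda>q. \<forall>s. s \<noteq> 0 \<longrightarrow>
    poly q s = 1 / s * (cf (f (a + kscale s v) $ i) \<alpha> - cf (f a $ i) \<alpha>)"
  have "(THE q. ?Q q) = q"
  proof (rule the_equality)
    show "?Q q"
      unfolding r(1) r0 by (subst pq) simp
    fix q' assume "?Q q'"
    then have "poly q' s = poly q s" if "s \<noteq> 0" for s
      using \<open>?Q q\<close> that by simp
    \<comment> \<open>The factor X hides the unspecified value at 0, so the products agree
      everywhere and X can be cancelled.\<close>
    then have "poly ([:0, 1:] * q') s = poly ([:0, 1:] * q) s" for s
      by (cases "s = 0") auto
    then have "[:0, 1:] * q' = [:0, 1:] * q" by (metis poly_eq_poly_eq_iff ext)
    then show "q' = q" by (metis mult_left_cancel pCons_eq_0_iff one_neq_zero)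
  qed
  moreover have "poly (pderiv r) 0 = poly q 0"
    by (subst rq) (simp add: pderiv_add pderiv_mult pderiv_pCons)
  ultimately show "cf (tangent f a v $ i) \<alpha> = cf (e' 0 $ i) \<alpha>"
    by (simp add: tangent_def r(2))
qed

text \<open>The differentials of the single coefficients are assembled into \<open>E\<close>;
  testing on lines at parameter 0 identifies \<open>E\<close> with the tangent map.\<close>

lemma textile_derivative:
  fixes F :: "('n::finite, 'k::field_char_0) cord ^ 'm::finite \<Rightarrow> ('n, 'k) cord ^ 'p::finite"
  assumes "textile F"
  shows "textile (\<lambda>a. tangent F a v)"
    and "path_deriv c c' \<Longrightarrow> path_deriv (\<lambda>t. F (c t)) (\<lambda>t. tangent F (c t) (c' t))"
proof -
  have "\<forall>i \<alpha>. \<exists>D. polyfun_deriv (\<lambda>c. cf (F c $ i) \<alpha>) D"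
    using assms by (simp add: textile_iff polyfun_deriv_ex)
  then obtain D where D: "\<And>i \<alpha>. polyfun_deriv (\<lambda>c. cf (F c $ i) \<alpha>) (D i \<alpha>)"
    by metis
  define E where "E a v = (\<chi> i. Cord (\<lambda>\<alpha>. D i \<alpha> a v))" for a v
  have E: "path_deriv (\<lambda>t. F (c t)) (\<lambda>t. E (c t) (c' t))" if "path_deriv c c'" for c c'
    using D that by (simp add: path_deriv_def[of "\<lambda>t. F (c t)"] E_def polyfun_deriv_def)
  have tan: "tangent F a v = E a v" for a v
  proof -
    have "a + kscale 0 v = a" by (rule vec_cord_eqI) simp
    then show ?thesis using tangent_eq_path_deriv[OF E[OF path_deriv_line]] by simp
  qed
  show "textile (\<lambda>a. tangent F a v)"
    unfolding tan using D by (simp add: textile_iff E_def polyfun_deriv_def)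
  show "path_deriv c c' \<Longrightarrow> path_deriv (\<lambda>t. F (c t)) (\<lambda>t. tangent F (c t) (c' t))"
    unfolding tan by (rule E)
qed

text \<open>The chain rule along the path \<open>G (a + kscale t v)\<close>, read off at t =
  0.\<close>

lemma tangent_compose:
  assumes "textile F" "textile G"
  shows "tangent (\<lambda>x. F (G x)) a v = tangent F (G a) (tangent G a v)"
proof -
  have "a + kscale 0 v = a" by (rule vec_cord_eqI) simp
  then show ?thesis
    using tangent_eq_path_deriv[where f = "\<lambda>x. F (G x)",
        OF textile_derivative(2)[OF assms(1) textile_derivative(2)[OF assms(2) path_deriv_line]]]
    by simp
qed

lemma tangent_linear:
  assumes "klinear_on UNIV G"
  shows "tangent G a v = G v"
proof -
  have "(\<lambda>t. G (a + kscale t v)) = (\<lambda>t. G a + kscale t (G v))"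
    using assms by (simp add: klinear_on_def)
  then show ?thesis
    using tangent_eq_path_deriv[of G a v "\<lambda>_. G v"] path_deriv_line[of "G a" "G v"] by simp
qed

lemma tangent_zero [simp]: "tangent f a 0 = 0"
proof -
  have "a + kscale t 0 = a" for t by (rule vec_cord_eqI) simp
  then show ?thesis using tangent_eq_path_deriv[of f a 0 "\<lambda>_. 0"] by (simp add: path_deriv_const)
qed

text \<open>The difference quotient involves only points of the ball. This allows a map that is
  textile on the ball to be replaced by a global textile extension.\<close>

lemma tangent_cong_ball:
  assumes "a \<in> madic_ball l" "v \<in> madic_ball l" "\<And>x. x \<in> madic_ball l \<Longrightarrow> f x = g x"
  shows "tangent f a v = tangent g a v"
  using assms by (simp add: tangent_def madic_ball_closed)

text \<open>The low coefficients vanish identically along a line, hence so do their derivatives.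
  This keeps the tangent vectors of the inverse \<open>w\<close> inside \<open>U\<close>.\<close>

lemma tangent_in_ball:
  fixes f :: "('n::finite, 'k::field_char_0) cord ^ 'm::finite \<Rightarrow> ('n, 'k) cord ^ 'p::finite"
  assumes "\<And>x. f x \<in> madic_ball l" "textile f"
  shows "tangent f a v \<in> madic_ball l"
  unfolding mem_madic_ball
proof (intro allI impI)
  fix i and \<alpha> :: "nat ^ 'n" assume d: "total_degree \<alpha> < l"
  have "path_deriv (\<lambda>t. f (a + kscale t v)) (\<lambda>t. tangent f (a + kscale t v) v)"
    by (rule textile_derivative(2)[OF assms(2) path_deriv_line])
  then obtain q where q: "\<And>t. cf (f (a + kscale t v) $ i) \<alpha> = poly q t"
    "\<And>t. cf (tangent f (a + kscale t v) v $ i) \<alpha> = poly (pderiv q) t"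
    unfolding path_deriv_def by metis
  have "poly q t = 0" for t using assms(1) d q(1) by (metis mem_madic_ball)
  then have "q = 0" by (simp add: poly_all_0_iff_0[symmetric])
  moreover have "a + kscale 0 v = a" by (rule vec_cord_eqI) simp
  ultimately show "cf (tangent f a v $ i) \<alpha> = 0" using q(2)[of 0] by simp
qed


section \<open>The rank theorem\<close>

theorem theorem1p2:
  fixes f L h :: "('n::finite, 'k::field_char_0) cord ^ 'm::finite \<Rightarrow> ('n, 'k) cord ^ 'p::finite"
    and \<sigma> :: "('n, 'k) cord ^ 'p \<Rightarrow> ('n, 'k) cord ^ 'm"
    and U :: "(('n, 'k) cord ^ 'm) set"
    and l :: nat
  assumes U: "U = madic_ball l"
    and f: "textile_on U f" "f 0 = 0"
    and tangent: "L = tangent f 0"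
    and remainder: "\<And>x. x \<in> U \<Longrightarrow> f x = L x + h x"
    and scission: "scission U UNIV L \<sigma>"
    and contractive: "contractive_on U (\<sigma> \<circ> h)"
    and rank: "constant_rank U f {y. L (\<sigma> y) = 0}"
  shows "\<exists>(u :: ('n, 'k) cord ^ 'm \<Rightarrow> ('n, 'k) cord ^ 'm) (v :: ('n, 'k) cord ^ 'p \<Rightarrow> ('n, 'k) cord ^ 'p).
    textile_on U u \<and> textile_on (f ` U) v \<and> u 0 = 0 \<and>
    locally_invertible_at_0 (f ` U) v \<and>
    (\<exists>N u_inv. local_inverse_at_0 U u N u_inv \<and>
      (\<exists>W. madic_nhd W \<and> W \<subseteq> u ` (N \<inter> U) \<inter> U \<and> (\<forall>y\<in>W. v (f (u_inv y)) = L y)))"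
proof -
  note [simp] = madic_ball_closed
  have Ladd: "L (x + y) = L x + L y" if "x \<in> U" "y \<in> U" for x y
    using scission that by (simp add: scission_def klinear_on_def)
  have Lscale: "L (kscale s x) = kscale s (L x)" if "x \<in> U" for x s
    using scission that by (simp add: scission_def klinear_on_def)
  have Ltex: "textile_on U L" and \<sigma>tex: "textile \<sigma>" and \<sigma>U: "\<And>y. \<sigma> y \<in> U"
    and L\<sigma>L: "\<And>x. x \<in> U \<Longrightarrow> L (\<sigma> (L x)) = L x"
    and \<sigma>add: "\<And>x y. \<sigma> (x + y) = \<sigma> x + \<sigma> y"
    and \<sigma>scale: "\<And>s x. \<sigma> (kscale s x) = kscale s (\<sigma> x)"
    using scission by (auto simp: scission_def klinear_on_def)
  \<comment> \<open>\<open>F\<close> and \<open>G\<close> are global textile extensions of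
    \<open>f\<close> and \<open>L\<close> from \<open>U\<close>; \<open>G\<close> may fail to be
    linear outside \<open>U\<close>.\<close>
  obtain F where F: "textile F" "\<And>x. x \<in> U \<Longrightarrow> f x = F x"
    using f(1) by (auto simp: textile_on_def)
  obtain G where G: "textile G" "\<And>x. x \<in> U \<Longrightarrow> L x = G x"
    using Ltex by (auto simp: textile_on_def)
  have L0: "L 0 = 0" using Ladd[of 0 0] by (simp add: U)

  \<comment> \<open>On \<open>U\<close> this is \<open>\<sigma> \<circ> h\<close>. As
    \<open>h\<close> is arbitrary elsewhere, \<open>F - G\<close> replaces it to obtain a globally
    textile map, with values in \<open>U\<close> because \<open>\<sigma>\<close> has them.\<close>
  define g where "g x = \<sigma> (F x - G x)" for x
  have g_eq: "g x = (\<sigma> \<circ> h) x" if "x \<in> U" for x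
    using remainder[OF that] F(2)[OF that] G(2)[OF that] by (simp add: g_def algebra_simps)
  have gtex: "textile g"
    unfolding g_def by (intro textile_compose[OF \<sigma>tex] textile_diff F G)
  have gU: "g x \<in> madic_ball l" for x
    using \<sigma>U U by (simp add: g_def)
  have gcontr: "contractive_on (madic_ball l) g"
    using contractive g_eq by (simp add: contractive_on_def U)
  obtain w where w: "textile w" "\<And>y. w y \<in> U" "\<And>y. y \<in> U \<Longrightarrow> w y + g (w y) = y"
    "\<And>x. x \<in> U \<Longrightarrow> w (x + g x) = x"
    using contractive_perturbation_inverse[OF gtex gU gcontr] unfolding U by metis
  have g0: "g 0 = 0"
    using F(2)[of 0] G(2)[of 0] f(2) L0 \<sigma>add[of 0 0] by (simp add: g_def U)
  have w0: "w 0 = 0"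
    using w(4)[of 0] g0 by (simp add: U)

  \<comment> \<open>\<open>w\<close> sends the whole space into \<open>U\<close>, so
    \<open>fw\<close> is globally textile and only values of \<open>f\<close> on \<open>U\<close>
    occur.\<close>
  define fw where "fw x = F (w x)" for x
  have fwtex: "textile fw"
    unfolding fw_def by (rule textile_compose[OF F(1) w(1)])
  have fw_eq: "fw x = f (w x)" for x
    using F(2) w(2) by (simp add: fw_def)
  have L\<sigma>fw: "L (\<sigma> (fw x)) = L x" if "x \<in> U" for x
  proof -
    \<comment> \<open>Applying \<open>\<sigma>\<close> turns the remainder into
      \<open>g (w x)\<close>; then \<open>L \<sigma> L = L\<close> and additivity lead to
      \<open>L (w x + g (w x))\<close>, which is \<open>L x\<close>.\<close>
    have "F (w x) = L (w x) + (F (w x) - G (w x))"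
      using G(2) w(2) by simp
    then have "\<sigma> (fw x) = \<sigma> (L (w x)) + g (w x)"
      unfolding fw_def g_def by (metis \<sigma>add)
    then have "L (\<sigma> (fw x)) = L (\<sigma> (L (w x))) + L (g (w x))"
      using Ladd \<sigma>U gU U by simp
    also have "\<dots> = L (w x + g (w x))"
      using Ladd L\<sigma>L w(2) gU U by simp
    finally show ?thesis using w(3) that by simp
  qed

  \<comment> \<open>This is the future \<open>v\<close>: the projection \<open>L \<sigma>\<close>
    onto the image of \<open>L\<close>, written with \<open>G\<close> so that textility follows by
    composition.\<close>
  define P where "P y = G (\<sigma> y)" for y
  have P_eq: "P y = L (\<sigma> y)" for y
    using G(2) \<sigma>U by (simp add: P_def)
  have Ptex: "textile P"
    unfolding P_def by (rule textile_compose[OF G(1) \<sigma>tex])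
  have Plin: "klinear_on UNIV P"
    using Ladd Lscale \<sigma>U by (simp add: klinear_on_def P_eq \<sigma>add \<sigma>scale)

  have Ptan: "P (tangent fw y v) = 0" if y: "y \<in> U" and v: "v \<in> U" "L v = 0" for y v
  proof -
    \<comment> \<open>\<open>P fw = L\<close> on \<open>U\<close>, and \<open>L\<close> is constant
      along the line since \<open>L v = 0\<close>.\<close>
    have "P (fw (y + kscale t v)) = L y" for t
    proof -
      have "kscale t 0 = (0 :: ('n, 'k) cord ^ 'p)" by (rule vec_cord_eqI) simp
      then show ?thesis
        using y v Ladd[of y "kscale t v"] Lscale[of v] L\<sigma>fw[of "y + kscale t v"]
        by (simp add: P_eq U)
    qed
    then have "tangent (\<lambda>x. P (fw x)) y v = 0"
      by (intro tangent_eq_path_deriv[of _ _ _ "\<lambda>_. 0"]) (simp add: path_deriv_const)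
    then show ?thesis
      by (simp add: tangent_compose[OF Ptex fwtex] tangent_linear[OF Plin])
  qed

  have tan0: "tangent fw y v = 0" if y: "y \<in> U" and v: "v \<in> U" "L v = 0" for y v
  proof -
    let ?V = "UNIV :: (('n, 'k) cord ^ 1) set"
    let ?J = "{y. L (\<sigma> y) = 0}"
    \<comment> \<open>The constant coefficient of \<open>s\<close> serves as a scalar:
      \<open>j 0 = 0\<close> gives the required start \<open>\<gamma> 0 = 0\<close>, while
      \<open>j 1 = y\<close> reaches the point in question.\<close>
    define j where "j s = kscale (cf (s $ 1) 0) y" for s :: "('n, 'k) cord ^ 1"
    have jtex: "textile j"
      unfolding textile_iff j_def cf_kscale
      by (intro allI polyfun.mult polyfun.coord polyfun.const)
    have jU: "j s \<in> U" for s using y by (simp add: j_def U)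
    define \<gamma> where "\<gamma> s = w (j s)" for s
    \<comment> \<open>By the chain rule, \<open>tangent f (\<gamma> s) (\<rho> s)\<close> is the
      derivative of \<open>fw\<close> at \<open>j s\<close> along \<open>v\<close>. Hence
      \<open>\<rho>\<close> and \<open>\<tau>\<close> decompose the zero curve, with
      \<open>\<tau>\<close> in \<open>?J\<close> by \<open>Ptan\<close>.\<close>
    define \<rho> where "\<rho> = (\<lambda>s. tangent w (j s) v)"
    define \<tau> where "\<tau> = (\<lambda>s. - tangent fw (j s) v)"
    have \<gamma>: "curve ?V U \<gamma>"
      unfolding curve_def \<gamma>_def using w(2)
      by (auto simp: madic_nhd_UNIV intro: textile_compose[OF w(1) jtex])
    have \<gamma>0: "\<gamma> 0 = 0"
    proof -
      have "j 0 = 0" unfolding j_def by (rule vec_cord_eqI) simp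
      then show ?thesis by (simp add: \<gamma>_def w0)
    qed
    have \<rho>U: "\<rho> s \<in> U" for s
      using tangent_in_ball[OF _ w(1)] w(2) by (simp add: \<rho>_def U)
    have \<rho>: "curve ?V U \<rho>"
      unfolding curve_def using \<rho>U textile_compose[OF textile_derivative(1)[OF w(1)] jtex]
      by (auto simp: madic_nhd_UNIV \<rho>_def)
    have "L (\<sigma> (- x)) = - L (\<sigma> x)" for x
      using Ladd[OF \<sigma>U \<sigma>U, of x "- x"] \<sigma>add[of x "- x"] \<sigma>add[of 0 0] L0
      by (simp add: eq_neg_iff_add_eq_0 add.commute)
    then have "L (\<sigma> (\<tau> s)) = 0" for s
      using Ptan[OF jU v] by (simp add: \<tau>_def P_eq)
    then have \<tau>: "curve ?V ?J \<tau>"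
      unfolding curve_def
      using textile_uminus[OF textile_compose[OF textile_derivative(1)[OF fwtex] jtex]]
      by (auto simp: madic_nhd_UNIV \<tau>_def)
    have T: "tangent f (\<gamma> s) (\<rho> s) = tangent fw (j s) v" for s
    proof -
      have "tangent f (\<gamma> s) (\<rho> s) = tangent F (\<gamma> s) (\<rho> s)"
        by (rule tangent_cong_ball[of _ l]) (use \<rho>U w(2) F(2) in \<open>auto simp: \<gamma>_def U\<close>)
      then show ?thesis
        unfolding fw_def by (simp add: \<gamma>_def \<rho>_def tangent_compose[OF F(1) w(1)])
    qed
    have zero: "curve ?V S (\<lambda>_. 0)" if "0 \<in> S" for S :: "(('n, 'k) cord ^ 'q::finite) set"
      using that by (auto simp: curve_def madic_nhd_UNIV textile_const)
    have "0 \<in> ?J" using \<sigma>add[of 0 0] L0 by simp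
    obtain \<rho>0 where \<rho>0: "\<And>\<rho>' \<tau>'. curve ?V U \<rho>' \<Longrightarrow> curve ?V ?J \<tau>' \<Longrightarrow>
        (\<And>s. 0 = tangent f (\<gamma> s) (\<rho>' s) + \<tau>' s) \<Longrightarrow>
        (\<forall>s. tangent f (\<gamma> s) (\<rho>' s) = tangent f (\<gamma> s) (\<rho>0 s))"
    proof -
      have "\<exists>\<rho>0 \<tau>0. curve ?V U \<rho>0 \<and> curve ?V ?J \<tau>0 \<and>
        (\<forall>s\<in>?V. 0 = tangent f (\<gamma> s) (\<rho>0 s) + \<tau>0 s) \<and>
        (\<forall>\<rho>' \<tau>'. curve ?V U \<rho>' \<and> curve ?V ?J \<tau>' \<and>
          (\<forall>s\<in>?V. 0 = tangent f (\<gamma> s) (\<rho>' s) + \<tau>' s) \<longrightarrow>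
          (\<forall>s\<in>?V. tangent f (\<gamma> s) (\<rho>' s) = tangent f (\<gamma> s) (\<rho>0 s) \<and> \<tau>' s = \<tau>0 s))"
        using rank[unfolded constant_rank_def] \<gamma> \<gamma>0 zero[of UNIV] by blast
      then show thesis using that by blast
    qed
    \<comment> \<open>This decomposition and the trivial one are both compared with
      \<open>\<rho>0\<close>; uniqueness forces the derivative of \<open>fw\<close> to
      vanish.\<close>
    have "\<forall>s. tangent f (\<gamma> s) (\<rho> s) = tangent f (\<gamma> s) (\<rho>0 s)"
      by (rule \<rho>0[OF \<rho> \<tau>]) (simp add: T \<tau>_def)
    moreover have "\<forall>s. tangent f (\<gamma> s) 0 = tangent f (\<gamma> s) (\<rho>0 s)"
      by (rule \<rho>0[OF zero zero[OF \<open>0 \<in> ?J\<close>]]) (simp_all add: U)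
    ultimately have "tangent fw (j s) v = 0" for s
      using T by simp
    moreover have "j 1 = y"
      unfolding j_def by (rule vec_cord_eqI) (simp add: one_cord.rep_eq)
    ultimately show ?thesis by metis
  qed

  have fw\<sigma>L: "fw (\<sigma> (L x)) = fw x" if x: "x \<in> U" for x
  proof -
    \<comment> \<open>\<open>z\<close> and \<open>x\<close> differ by an element of
      \<open>ker L\<close>, and the line joining them stays in \<open>U\<close>, so
      \<open>tan0\<close> applies at each of its points.\<close>
    define z where "z = \<sigma> (L x)"
    define v where "v = x - z"
    have z: "z \<in> U" using \<sigma>U by (simp add: z_def)
    have v: "v \<in> U" using x z by (simp add: v_def U)
    have "L (z + v) = L z + L v" by (rule Ladd[OF z v])
    then have Lv: "L v = 0"
      using L\<sigma>L[OF x] by (simp add: v_def z_def)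
    have "path_deriv (\<lambda>t. fw (z + kscale t v)) (\<lambda>t. tangent fw (z + kscale t v) v)"
      by (rule textile_derivative(2)[OF fwtex path_deriv_line])
    then have "path_deriv (\<lambda>t. fw (z + kscale t v)) (\<lambda>_. 0)"
      using tan0[OF _ v Lv] z v by (simp add: U)
    then have "fw (z + kscale 0 v) = fw (z + kscale 1 v)"
      by (rule path_deriv_zero_imp_const)
    moreover have "z + kscale 0 v = z" "z + kscale 1 v = x"
      by (rule vec_cord_eqI, simp add: v_def)+
    ultimately show ?thesis by (simp add: z_def)
  qed

  define u where "u x = x + g x" for x
  have utex: "textile u"
    unfolding u_def by (intro textile_add textile_ident gtex)
  have uU: "u x \<in> U" if "x \<in> U" for x
    using that gU by (simp add: u_def U)
  \<comment> \<open>The neighbourhood is \<open>UNIV\<close>: the inverse is valid on all of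
    \<open>U\<close>, not merely near 0.\<close>
  have u_inv: "local_inverse_at_0 U u UNIV w"
    using w(4) by (simp add: local_inverse_at_0_def madic_nhd_UNIV u_def textile_imp_textile_on[OF w(1)])
  have "fw (\<sigma> (P (f x))) = f x" if x: "x \<in> U" for x
  proof -
    have "f x = fw (u x)" using w(4)[OF x] by (simp add: fw_eq u_def)
    then show ?thesis
      using L\<sigma>fw[OF uU[OF x]] fw\<sigma>L[OF uU[OF x]] by (simp add: P_eq)
  qed
  then have "local_inverse_at_0 (f ` U) P UNIV (\<lambda>y. fw (\<sigma> y))"
    by (auto simp: local_inverse_at_0_def madic_nhd_UNIV
        intro!: textile_imp_textile_on textile_compose[OF fwtex \<sigma>tex])
  \<comment> \<open>Surjectivity of \<open>u\<close> onto \<open>U\<close> lets \<open>U\<close>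
    itself be the neighbourhood \<open>W\<close> for the normal form.\<close>
  moreover have "U \<subseteq> u ` (UNIV \<inter> U) \<inter> U"
  proof
    fix y assume "y \<in> U"
    then have "y = u (w y)" using w(3) by (simp add: u_def)
    then show "y \<in> u ` (UNIV \<inter> U) \<inter> U" using w(2) \<open>y \<in> U\<close> by blast
  qed
  moreover have "P (f (w y)) = L y" if "y \<in> U" for y
    using L\<sigma>fw[OF that] by (simp add: P_eq fw_eq)
  moreover have "madic_nhd U" by (auto simp: madic_nhd_def U)
  moreover have "u 0 = 0" by (simp add: u_def g0)
  ultimately show ?thesis
    using u_inv textile_imp_textile_on[OF utex] textile_imp_textile_on[OF Ptex]
    unfolding locally_invertible_at_0_def by blast
qed

end
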